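(* Let $k\ge n\ge 1$, let $A=(f_1,\dots,f_k)$ be a system of $k$ tropical polynomials in $n$ variables, and let $x\in\mathbb{R}^n$ be an isolated solution of $A$. Then one can choose $2k$ monomials $m_{i,j}$, $1\le i\le k$, $1\le j\le 2$, such that: (1) for each $i$, the monomials $m_{i,1}$ and $m_{i,2}$ are taken from the $i$-th polynomial $f_i$ and are starred (in row $i$) in $A^{*x}$; (2) the linear span of the vectors $v_n(m_{1,1},m_{1,2}),\,v_n(m_{2,1},m_{2,2}),\dots,v_n(m_{k,1},m_{k,2})$ has dimension $n$.
   Context: A tropical polynomial $f$ in $n$ variables is given by a nonempty finite set of tropical monomials $Q_j(x)=a_j+i_{j1}x_1+\cdots+i_{jn}x_n$ with $a_j\in\mathbb{R}$ and pairwise distinct exponent vectors $(i_{j1},\dots,i_{jn})\in\mathbb{Z}_{\ge 0}^n$; $f(x)=\min_j Q_j(x)$. A point $x\in\mathbb{R}^n$ is a tropical zero of $f$ if $\min_j Q_j(x)$ is attained for at least two different $j$. A solution of $A$ is a point of $\mathbb{R}^n$ that is a tropical zero of every $f_i$; an isolated solution is an isolated point of the set of all solutions. Star table: the entry $(i,m)$ of $A^{*x}$ (rows: polynomials of $A$; columns: monomials) carries a star if and only if the monomial with exponent vector $m$ occurs in $f_i$ and attains at $x$ the minimal value among all monomials of $f_i$. For tropical monomials $m_1,m_2$ with exponent vectors $p_n(m_1),p_n(m_2)$, put $v_n(m_1,m_2)=p_n(m_2)-p_n(m_1)\in\mathbb{R}^n$. *)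

theory Defs
  imports "HOL-Analysis.Analysis"
begin

text \<open>A tropical monomial is a pair of its coefficient and its exponent vector; the number of
  variables is \<open>CARD('n)\<close>, which is automatically positive.\<close>

type_synonym 'n trop_monomial = "real \<times> (nat ^ 'n)"

definition coefficient :: "'n::finite trop_monomial \<Rightarrow> real" where
  "coefficient m = fst m"

definition exponents :: "'n::finite trop_monomial \<Rightarrow> nat ^ 'n" where
  "exponents m = snd m"

definition monomial_value :: "'n::finite trop_monomial \<Rightarrow> real ^ 'n \<Rightarrow> real" where
  "monomial_value m x = coefficient m + (\<Sum>l\<in>UNIV. real (exponents m $ l) * x $ l)"

definition trop_polynomial :: "'n::finite trop_monomial set \<Rightarrow> bool" where
  "trop_polynomial f \<longleftrightarrow> finite f \<and> f \<noteq> {} \<and> inj_on exponents f"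

definition trop_value :: "'n::finite trop_monomial set \<Rightarrow> real ^ 'n \<Rightarrow> real" where
  "trop_value f x = Min ((\<lambda>m. monomial_value m x) ` f)"

definition trop_zero :: "'n::finite trop_monomial set \<Rightarrow> real ^ 'n \<Rightarrow> bool" where
  "trop_zero f x \<longleftrightarrow>
     (\<exists>m\<in>f. \<exists>m'\<in>f. m \<noteq> m' \<and> monomial_value m x = trop_value f x
                        \<and> monomial_value m' x = trop_value f x)"

text \<open>A system of \<open>k\<close> polynomials is a function on \<open>nat\<close>, of which only the values
  on \<open>{1..k}\<close> are used.\<close>

definition solutions :: "nat \<Rightarrow> (nat \<Rightarrow> 'n::finite trop_monomial set) \<Rightarrow> (real ^ 'n) set" where
  "solutions k A = {x. \<forall>i\<in>{1..k}. trop_zero (A i) x}"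

text \<open>The star table at \<open>x\<close>: rows are indices of polynomials, columns are exponent vectors.\<close>

definition starred ::
  "(nat \<Rightarrow> 'n::finite trop_monomial set) \<Rightarrow> real ^ 'n \<Rightarrow> nat \<Rightarrow> nat ^ 'n \<Rightarrow> bool" where
  "starred A x i p \<longleftrightarrow>
     (\<exists>m\<in>A i. exponents m = p \<and> monomial_value m x = trop_value (A i) x)"

definition exponent_point :: "'n::finite trop_monomial \<Rightarrow> real ^ 'n" where
  "exponent_point m = (\<chi> l. real (exponents m $ l))"

definition exponent_diff :: "'n::finite trop_monomial \<Rightarrow> 'n trop_monomial \<Rightarrow> real ^ 'n" where
  "exponent_diff m1 m2 = exponent_point m2 - exponent_point m1"

end

theory Submission
  imports Defs
begin

text \<open>Only the monomials starred at \<open>x\<close> matter near \<open>x\<close>: in a direction \<open>d\<close>, the point \<open>x + t d\<close>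
  with small \<open>t > 0\<close> is a solution as soon as, for every \<open>i\<close>, the minimum of \<open>p \<bullet> d\<close> over the
  starred exponent points \<open>p\<close> of the \<open>i\<close>-th polynomial is attained twice. Since \<open>x\<close> is isolated,
  every direction \<open>d \<noteq> 0\<close> therefore has an \<open>i\<close> for which the minimiser is unique.

  Choose for each starred point \<open>p\<close> of the \<open>i\<close>-th polynomial another starred point \<open>\<sigma>\<^sub>i p\<close> of the
  same polynomial. Whenever \<open>p\<close> is the unique minimiser for \<open>d\<close>, the difference \<open>\<sigma>\<^sub>i p - p\<close> has
  positive inner product with \<open>d\<close>. Weighting these differences by continuous functions that vanish
  off the region of unique minimality gives a continuous field \<open>h\<close> with \<open>d \<bullet> h d > 0\<close> for
  \<open>d \<noteq> 0\<close>, so by Brouwer's theorem \<open>h\<close> takes every value close to \<open>0\<close>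
  (\<open>outward_field_covers_ball\<close>). On the other hand, at each \<open>d\<close> at most one point \<open>p\<^sub>i\<close> per
  polynomial has nonzero weight, so \<open>h d\<close> lies in the span of the vectors \<open>\<sigma>\<^sub>i p\<^sub>i - p\<^sub>i\<close>. Finitely
  many such spans cover a ball, hence one of them is the whole space, and the pairs
  \<open>p\<^sub>i, \<sigma>\<^sub>i p\<^sub>i\<close> that define it are the required ones
  (\<open>unique_minimisers_imp_spanning_differences\<close>).\<close>

section \<open>Outward-pointing fields on a ball\<close>

text \<open>If \<open>g\<close> had no zero, \<open>- g x / norm (g x)\<close> would map the ball to its boundary without a fixed
  point, because on the boundary it points inwards.\<close>

lemma outward_field_has_zero:
  fixes g :: "'a::euclidean_space \<Rightarrow> 'a"
  assumes cont: "continuous_on (cball 0 1) g"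
    and out: "\<And>x. norm x = 1 \<Longrightarrow> 0 < x \<bullet> g x"
  shows "\<exists>x\<in>cball 0 1. g x = 0"
proof (rule ccontr)
  assume "\<not> ?thesis"
  then have nz: "g x \<noteq> 0" if "x \<in> cball 0 1" for x
    using that by blast
  define r where "r x = - (g x /\<^sub>R norm (g x))" for x
  have "continuous_on (cball 0 1) r"
    unfolding r_def using nz by (intro continuous_intros cont) auto
  moreover have norm_r: "norm (r x) = 1" if "x \<in> cball 0 1" for x
    using nz[OF that] by (simp add: r_def)
  then have "r \<in> cball 0 1 \<rightarrow> cball 0 1"
    by simp
  ultimately obtain x where x: "x \<in> cball 0 1" "r x = x"
    using brouwer[of "cball (0::'a) 1" r] by auto
  then have "norm x = 1"
    using norm_r by metis
  then have "0 < x \<bullet> g x"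
    by (rule out)
  moreover have "x \<bullet> x = - ((x \<bullet> g x) / norm (g x))"
    by (subst (2) x(2)[symmetric]) (simp add: r_def divide_inverse mult.commute)
  ultimately show False
    using nz[OF x(1)] inner_ge_zero[of x]
    by (smt (verit) divide_pos_pos zero_less_norm_iff)
qed

lemma outward_field_covers_ball:
  fixes h :: "'a::euclidean_space \<Rightarrow> 'a"
  assumes cont: "continuous_on (cball 0 1) h"
    and out: "\<And>x. norm x = 1 \<Longrightarrow> 0 < x \<bullet> h x"
  shows "\<exists>c>0. ball 0 c \<subseteq> h ` cball 0 1"
proof -
  have "compact (sphere (0::'a) 1)" "sphere (0::'a) 1 \<noteq> {}"
    by auto
  moreover have "continuous_on (sphere 0 1) (\<lambda>x. x \<bullet> h x)"
    by (intro continuous_intros continuous_on_subset[OF cont]) auto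
  ultimately obtain x0 where x0: "x0 \<in> sphere 0 1"
      "\<And>x. x \<in> sphere 0 1 \<Longrightarrow> x0 \<bullet> h x0 \<le> x \<bullet> h x"
    using continuous_attains_inf[of "sphere (0::'a) 1" "\<lambda>x. x \<bullet> h x"] by metis
  \<comment> \<open>On the sphere \<open>x \<bullet> u \<le> norm u\<close>, so \<open>h - u\<close> still points outwards when \<open>norm u\<close> is below
    the minimum of \<open>x \<bullet> h x\<close>.\<close>
  have "ball 0 (x0 \<bullet> h x0) \<subseteq> h ` cball 0 1"
  proof
    fix u :: 'a
    assume u: "u \<in> ball 0 (x0 \<bullet> h x0)"
    have "0 < x \<bullet> (h x - u)" if "norm x = 1" for x
    proof -
      have "x \<bullet> u \<le> norm u"
        using norm_cauchy_schwarz[of x u] that by simp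
      then show ?thesis
        using x0(2)[of x] u that by (simp add: inner_diff_right)
    qed
    moreover have "continuous_on (cball 0 1) (\<lambda>x. h x - u)"
      by (intro continuous_intros cont)
    ultimately obtain x where "x \<in> cball 0 1" "h x - u = 0"
      using outward_field_has_zero[of "\<lambda>x. h x - u"] by blast
    then show "u \<in> h ` cball 0 1"
      by (intro image_eqI[of _ _ x]) auto
  qed
  then show ?thesis
    using out[of x0] x0(1) by auto
qed

section \<open>Spanning differences from unique minimisers\<close>

text \<open>Proper subspaces are Lebesgue null sets, and a ball is not.\<close>

lemma ball_covered_by_spans:
  fixes S :: "'b \<Rightarrow> 'a::euclidean_space set"
  assumes "finite F" "0 < c" "ball 0 c \<subseteq> (\<Union>f\<in>F. span (S f))"
  shows "\<exists>f\<in>F. dim (S f) = DIM('a)"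
proof (rule ccontr)
  assume "\<not> ?thesis"
  then have "dim (span (S f)) < DIM('a)" if "f \<in> F" for f
    using that dim_subset_UNIV[of "S f"] by (simp add: order_less_le)
  then have "negligible (\<Union>f\<in>F. span (S f))"
    using assms(1) by (intro negligible_Union) (auto intro: negligible_lowdim)
  then have "negligible (ball (0::'a) c)"
    using assms(3) negligible_subset by blast
  then show False
    using open_not_negligible[of "ball (0::'a) c"] assms(2) by simp
qed

text \<open>The weight \<open>\<Prod>q\<in>P i - {p}. max 0 ((q - p) \<bullet> d)\<close> is continuous in \<open>d\<close> and is nonzero exactly
  when \<open>p\<close> is the unique minimiser of \<open>p \<bullet> d\<close> on \<open>P i\<close>.\<close>

lemma unique_minimisers_imp_spanning_differences:
  fixes P :: "'i \<Rightarrow> 'a::euclidean_space set"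
  assumes finI: "finite I"
    and finP: "\<And>i. i \<in> I \<Longrightarrow> finite (P i)"
    and other: "\<And>i p. i \<in> I \<Longrightarrow> \<exists>q\<in>P i. q \<noteq> p"
    and unique: "\<And>d. d \<noteq> 0 \<Longrightarrow> \<exists>i\<in>I. \<exists>p\<in>P i. \<forall>q\<in>P i - {p}. p \<bullet> d < q \<bullet> d"
  shows "\<exists>p q. (\<forall>i\<in>I. p i \<in> P i \<and> q i \<in> P i) \<and> dim ((\<lambda>i. q i - p i) ` I) = DIM('a)"
proof -
  have "\<forall>i p. \<exists>q. i \<in> I \<longrightarrow> q \<in> P i \<and> q \<noteq> p"
    using other by blast
  then obtain \<sigma> where \<sigma>: "\<And>i p. i \<in> I \<Longrightarrow> \<sigma> i p \<in> P i \<and> \<sigma> i p \<noteq> p"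
    by metis
  define w where "w i p d = (\<Prod>q\<in>P i - {p}. max 0 ((q - p) \<bullet> d))" for i p d
  define h where "h d = (\<Sum>i\<in>I. \<Sum>p\<in>P i. w i p d *\<^sub>R (\<sigma> i p - p))" for d
  have w_nonneg: "0 \<le> w i p d" for i p d
    unfolding w_def by (intro prod_nonneg) auto
  have w_nz: "w i p d \<noteq> 0 \<longleftrightarrow> (\<forall>q\<in>P i - {p}. p \<bullet> d < q \<bullet> d)" if "i \<in> I" for i p d
  proof -
    have "max 0 ((q - p) \<bullet> d) \<noteq> 0 \<longleftrightarrow> p \<bullet> d < q \<bullet> d" for q
      by (auto simp: inner_diff_left max_def)
    then show ?thesis
      using finP[OF that] by (simp add: w_def)
  qed
  have term_pos: "0 < d \<bullet> (w i p d *\<^sub>R (\<sigma> i p - p))" if "i \<in> I" "w i p d \<noteq> 0" for i p d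
  proof -
    have "p \<bullet> d < \<sigma> i p \<bullet> d"
      using w_nz[of i p d] \<sigma>[of i p] that by blast
    then show ?thesis
      using w_nonneg[of i p d] that(2) by (simp add: inner_diff_left inner_commute[of d])
  qed
  have term_nonneg: "0 \<le> d \<bullet> (w i p d *\<^sub>R (\<sigma> i p - p))" if "i \<in> I" for i p d
    using term_pos[OF that, of p d] by (cases "w i p d = 0") auto
  have "0 < d \<bullet> h d" if "norm d = 1" for d
  proof -
    from that have "d \<noteq> 0" by auto
    then obtain i p where ip: "i \<in> I" "p \<in> P i" "w i p d \<noteq> 0"
      using unique w_nz by metis
    have "0 < (\<Sum>p\<in>P i. d \<bullet> (w i p d *\<^sub>R (\<sigma> i p - p)))"
      using ip by (intro sum_pos2[of _ p] finP term_pos term_nonneg)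
    then have "0 < (\<Sum>i\<in>I. \<Sum>p\<in>P i. d \<bullet> (w i p d *\<^sub>R (\<sigma> i p - p)))"
      using ip by (intro sum_pos2[of _ i] finI sum_nonneg term_nonneg)
    then show ?thesis
      by (simp only: h_def inner_sum_right)
  qed
  moreover have "continuous_on (cball 0 1) h"
    unfolding h_def w_def by (intro continuous_intros)
  ultimately obtain c where c: "0 < c" "ball 0 c \<subseteq> h ` cball 0 1"
    using outward_field_covers_ball by blast
  have "h d \<in> (\<Union>f\<in>PiE I P. span ((\<lambda>i. \<sigma> i (f i) - f i) ` I))" for d
  proof -
    \<comment> \<open>At most one point of each \<open>P i\<close> has nonzero weight; where none has, any point will do.\<close>
    have "\<exists>p\<in>P i. \<forall>p'\<in>P i. p' \<noteq> p \<longrightarrow> w i p' d = 0" if "i \<in> I" for i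
    proof (cases "\<exists>p\<in>P i. w i p d \<noteq> 0")
      case True
      then obtain p where p: "p \<in> P i" "\<forall>q\<in>P i - {p}. p \<bullet> d < q \<bullet> d"
        using w_nz[OF \<open>i \<in> I\<close>] by blast
      have "w i p' d = 0" if "p' \<in> P i" "p' \<noteq> p" for p'
      proof -
        have "p \<bullet> d < p' \<bullet> d"
          using p(2) that by blast
        then have "\<not> (\<forall>q\<in>P i - {p'}. p' \<bullet> d < q \<bullet> d)"
          using p(1) that(2) by (metis DiffI not_less_iff_gr_or_eq singletonD)
        then show ?thesis
          using w_nz[OF \<open>i \<in> I\<close>] by blast
      qed
      then show ?thesis using p(1) by blast
    next
      case False
      then show ?thesis using other[OF that] by blast
    qed
    then obtain f where f: "\<And>i. i \<in> I \<Longrightarrow> f i \<in> P i"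
        "\<And>i p'. i \<in> I \<Longrightarrow> p' \<in> P i \<Longrightarrow> p' \<noteq> f i \<Longrightarrow> w i p' d = 0"
      by metis
    let ?S = "(\<lambda>i. \<sigma> i (restrict f I i) - restrict f I i) ` I"
    have "(\<Sum>p\<in>P i. w i p d *\<^sub>R (\<sigma> i p - p)) \<in> span ?S" if "i \<in> I" for i
    proof -
      have "w i p d *\<^sub>R (\<sigma> i p - p) \<in> span ?S" if "p \<in> P i" for p
      proof (cases "p = f i")
        case True
        then show ?thesis
          using \<open>i \<in> I\<close> by (intro span_scale span_base image_eqI[of _ _ i]) auto
      next
        case False
        then show ?thesis
          using f(2)[OF \<open>i \<in> I\<close> that] by (simp add: span_zero)
      qed
      then show ?thesis by (intro span_sum)
    qed
    then have "h d \<in> span ?S"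
      unfolding h_def by (rule span_sum)
    moreover have "restrict f I \<in> PiE I P"
      using f(1) by auto
    ultimately show ?thesis by blast
  qed
  then have "ball 0 c \<subseteq> (\<Union>f\<in>PiE I P. span ((\<lambda>i. \<sigma> i (f i) - f i) ` I))"
    using c(2) by blast
  moreover have "finite (PiE I P)"
    by (intro finite_PiE finI finP)
  ultimately obtain f where f: "f \<in> PiE I P" "dim ((\<lambda>i. \<sigma> i (f i) - f i) ` I) = DIM('a)"
    using ball_covered_by_spans[of "PiE I P" c "\<lambda>f. (\<lambda>i. \<sigma> i (f i) - f i) ` I"] c(1) by blast
  have "\<forall>i\<in>I. f i \<in> P i \<and> \<sigma> i (f i) \<in> P i"
    using f(1) \<sigma> by auto
  with f(2) show ?thesis
    by (intro exI[of _ f] exI[of _ "\<lambda>i. \<sigma> i (f i)"]) blast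
qed

section \<open>Tropical zeros near an isolated solution\<close>

definition minimal_monomials :: "'n::finite trop_monomial set \<Rightarrow> real ^ 'n \<Rightarrow> 'n trop_monomial set"
  where "minimal_monomials f x = {m \<in> f. monomial_value m x = trop_value f x}"

lemma monomial_value_shift:
  "monomial_value m (x + t *\<^sub>R d) = monomial_value m x + t * (exponent_point m \<bullet> d)"
  by (simp add: monomial_value_def exponent_point_def inner_vec_def distrib_left sum.distrib
      sum_distrib_left mult.left_commute add.assoc)

lemma trop_value_eqI:
  assumes "finite f" "m \<in> f" "\<And>r. r \<in> f \<Longrightarrow> monomial_value m y \<le> monomial_value r y"
  shows "trop_value f y = monomial_value m y"
  unfolding trop_value_def using assms by (intro Min_eqI) auto

lemma trop_value_le:
  assumes "finite f" "m \<in> f"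
  shows "trop_value f x \<le> monomial_value m x"
  unfolding trop_value_def using assms by (intro Min_le) auto

text \<open>Monomials that are not minimal at \<open>x\<close> stay above the minimum for small \<open>t\<close>, so a tie between
  minimal monomials in direction \<open>d\<close> persists along a short segment.\<close>

lemma trop_zero_along_tied_direction:
  assumes fin: "finite f"
    and m: "m \<in> minimal_monomials f x" "m' \<in> minimal_monomials f x" "m \<noteq> m'"
    and tie: "exponent_point m' \<bullet> d = exponent_point m \<bullet> d"
    and least: "\<And>r. r \<in> minimal_monomials f x \<Longrightarrow> exponent_point m \<bullet> d \<le> exponent_point r \<bullet> d"
  shows "\<forall>\<^sub>F t in at_right 0. trop_zero f (x + t *\<^sub>R d)"
proof -
  have "\<forall>\<^sub>F t in at_right 0. monomial_value m (x + t *\<^sub>R d) \<le> monomial_value r (x + t *\<^sub>R d)"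
    if r: "r \<in> f" for r
  proof (cases "r \<in> minimal_monomials f x")
    case True
    have "monomial_value m (x + t *\<^sub>R d) \<le> monomial_value r (x + t *\<^sub>R d)" if "0 < t" for t
      using least[OF True] True m(1) that
      by (simp add: monomial_value_shift minimal_monomials_def)
    then show ?thesis
      by (rule eventually_mono[OF eventually_at_right_less])
  next
    case False
    then have less: "monomial_value m x < monomial_value r x"
      using trop_value_le[OF fin r, of x] r m(1) by (auto simp: minimal_monomials_def)
    have "((\<lambda>t. monomial_value r (x + t *\<^sub>R d) - monomial_value m (x + t *\<^sub>R d)) \<longlongrightarrow>
        monomial_value r x + 0 * (exponent_point r \<bullet> d)
        - (monomial_value m x + 0 * (exponent_point m \<bullet> d))) (at_right 0)"
      unfolding monomial_value_shift by (intro tendsto_intros)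
    then have "\<forall>\<^sub>F t in at_right 0.
        0 < monomial_value r (x + t *\<^sub>R d) - monomial_value m (x + t *\<^sub>R d)"
      using less by (intro order_tendstoD(1)) auto
    then show ?thesis
      by (rule eventually_mono) simp
  qed
  then have "\<forall>\<^sub>F t in at_right 0. \<forall>r\<in>f.
      monomial_value m (x + t *\<^sub>R d) \<le> monomial_value r (x + t *\<^sub>R d)"
    using fin by (simp add: eventually_ball_finite)
  then show ?thesis
  proof (rule eventually_mono)
    fix t
    assume "\<forall>r\<in>f. monomial_value m (x + t *\<^sub>R d) \<le> monomial_value r (x + t *\<^sub>R d)"
    then have "trop_value f (x + t *\<^sub>R d) = monomial_value m (x + t *\<^sub>R d)"
      using fin m(1) by (intro trop_value_eqI) (auto simp: minimal_monomials_def)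
    moreover have "monomial_value m' (x + t *\<^sub>R d) = monomial_value m (x + t *\<^sub>R d)"
      using m tie by (simp add: monomial_value_shift minimal_monomials_def)
    ultimately show "trop_zero f (x + t *\<^sub>R d)"
      using m unfolding trop_zero_def minimal_monomials_def by force
  qed
qed

text \<open>If the minimum were attained twice for every \<open>i\<close>, the points \<open>x + t d\<close> would be solutions
  accumulating at \<open>x\<close>.\<close>

lemma isolated_solution_unique_minimiser:
  fixes A :: "nat \<Rightarrow> 'n::finite trop_monomial set"
  assumes poly: "\<And>i. i \<in> {1..k} \<Longrightarrow> trop_polynomial (A i)"
    and iso: "x isolated_in solutions k A"
    and d: "d \<noteq> 0"
  shows "\<exists>i\<in>{1..k}. \<exists>m\<in>minimal_monomials (A i) x.
           \<forall>r\<in>minimal_monomials (A i) x - {m}. exponent_point m \<bullet> d < exponent_point r \<bullet> d"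
proof (rule ccontr)
  assume contra: "\<not> ?thesis"
  have sol: "x \<in> solutions k A"
    using iso by (simp add: isolated_in_def)
  have "\<forall>\<^sub>F t in at_right 0. trop_zero (A i) (x + t *\<^sub>R d)" if i: "i \<in> {1..k}" for i
  proof -
    let ?M = "minimal_monomials (A i) x"
    have fin: "finite (A i)"
      using poly[OF i] by (simp add: trop_polynomial_def)
    have "?M \<noteq> {}"
      using sol i unfolding minimal_monomials_def solutions_def trop_zero_def by blast
    moreover have "finite ?M"
      using fin by (simp add: minimal_monomials_def)
    ultimately obtain m where m: "m \<in> ?M" "\<And>r. r \<in> ?M \<Longrightarrow> exponent_point m \<bullet> d \<le> exponent_point r \<bullet> d"
      using ex_is_arg_min_if_finite[of ?M "\<lambda>r. exponent_point r \<bullet> d"]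
      by (auto simp: is_arg_min_linorder)
    obtain m' where "m' \<in> ?M" "m' \<noteq> m" "\<not> exponent_point m \<bullet> d < exponent_point m' \<bullet> d"
      using contra i m(1) by blast
    then show ?thesis
      using m(2)[of m'] trop_zero_along_tied_direction[OF fin m(1) _ _ _ m(2), of m']
      by (simp add: not_less)
  qed
  then have "\<forall>\<^sub>F t in at_right 0. \<forall>i\<in>{1..k}. trop_zero (A i) (x + t *\<^sub>R d)"
    by (intro eventually_ball_finite) auto
  then have ev_sol: "\<forall>\<^sub>F t in at_right 0. x + t *\<^sub>R d \<in> solutions k A"
    by (simp add: solutions_def)
  obtain T where T: "open T" "T \<inter> solutions k A = {x}"
    using iso by (auto simp: isolated_in_def)
  have "((\<lambda>t. x + t *\<^sub>R d) \<longlongrightarrow> x + 0 *\<^sub>R d) (at_right 0)"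
    by (intro tendsto_intros)
  then have "\<forall>\<^sub>F t in at_right 0. x + t *\<^sub>R d \<in> T"
    using T by (intro topological_tendstoD) auto
  with ev_sol have "\<forall>\<^sub>F t in at_right (0::real). False"
    using eventually_at_right_less[of "0::real"]
  proof eventually_elim
    case (elim t)
    then have "x + t *\<^sub>R d = x" using T(2) by blast
    then show False using elim d by simp
  qed
  then show False by simp
qed

lemma exponent_point_inj_on:
  assumes "trop_polynomial f"
  shows "inj_on exponent_point f"
  using assms unfolding trop_polynomial_def inj_on_def exponent_point_def
  by (auto simp: vec_eq_iff)

theorem theorem7p1:
  fixes k :: nat
    and A :: "nat \<Rightarrow> 'n::finite trop_monomial set"
    and x :: "real ^ 'n"
  assumes "CARD('n) \<le> k"
    and "\<And>i. i \<in> {1..k} \<Longrightarrow> trop_polynomial (A i)"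
    and "x isolated_in solutions k A"
  shows "\<exists>m :: nat \<Rightarrow> nat \<Rightarrow> 'n trop_monomial.
           (\<forall>i\<in>{1..k}. \<forall>j\<in>{1..2}. m i j \<in> A i \<and> starred A x i (exponents (m i j))) \<and>
           dim (span ((\<lambda>i. exponent_diff (m i 1) (m i 2)) ` {1..k})) = CARD('n)"
proof -
  define M where "M i = minimal_monomials (A i) x" for i
  have M_sub: "M i \<subseteq> A i" for i
    by (auto simp: M_def minimal_monomials_def)
  have inj: "inj_on exponent_point (M i)" if "i \<in> {1..k}" for i
    using exponent_point_inj_on[OF assms(2)[OF that]] M_sub by (rule inj_on_subset)
  have "finite (exponent_point ` M i)" if "i \<in> {1..k}" for i
    using assms(2)[OF that] M_sub[of i] by (auto simp: trop_polynomial_def intro: finite_subset)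
  moreover have "\<exists>q\<in>exponent_point ` M i. q \<noteq> p" if i: "i \<in> {1..k}" for i p
  proof -
    have "x \<in> solutions k A"
      using assms(3) by (simp add: isolated_in_def)
    then obtain m m' where "m \<in> M i" "m' \<in> M i" "m \<noteq> m'"
      using i unfolding solutions_def trop_zero_def M_def minimal_monomials_def by blast
    then show ?thesis
      using inj_onD[OF inj[OF i]] by (metis imageI)
  qed
  moreover have "\<exists>i\<in>{1..k}. \<exists>p\<in>exponent_point ` M i.
      \<forall>q\<in>exponent_point ` M i - {p}. p \<bullet> d < q \<bullet> d" if "d \<noteq> 0" for d
    using isolated_solution_unique_minimiser[OF assms(2,3) that] unfolding M_def by blast
  ultimately obtain p q where pq: "\<And>i. i \<in> {1..k} \<Longrightarrow> p i \<in> exponent_point ` M i \<and> q i \<in> exponent_point ` M i"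
      and dim: "dim ((\<lambda>i. q i - p i) ` {1..k}) = DIM(real ^ 'n)"
    using unique_minimisers_imp_spanning_differences[of "{1..k}" "\<lambda>i. exponent_point ` M i"]
    by (metis (no_types, lifting) finite_atLeastAtMost)
  have "\<forall>i. \<exists>a b. i \<in> {1..k} \<longrightarrow> a \<in> M i \<and> b \<in> M i \<and> p i = exponent_point a \<and> q i = exponent_point b"
    using pq by blast
  then obtain a b where ab: "\<And>i. i \<in> {1..k} \<Longrightarrow>
      a i \<in> M i \<and> b i \<in> M i \<and> p i = exponent_point (a i) \<and> q i = exponent_point (b i)"
    by metis
  define m where "m i j = (if j = 1 then a i else b i)" for i and j :: nat
  have "m i j \<in> A i \<and> starred A x i (exponents (m i j))" if "i \<in> {1..k}" for i j
    using ab[OF that] by (auto simp: m_def starred_def M_def minimal_monomials_def)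
  moreover have "(\<lambda>i. exponent_diff (m i 1) (m i 2)) ` {1..k} = (\<lambda>i. q i - p i) ` {1..k}"
    using ab by (intro image_cong) (auto simp: m_def exponent_diff_def)
  ultimately show ?thesis
    using dim by (intro exI[of _ m]) (simp add: dim_span)
qed

end
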